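(* Let $t_m$ ($m\ge -2$) be the Tribonacci numbers with $t_{-2}=0$, $t_{-1}=t_0=1$, $t_m=t_{m-1}+t_{m-2}+t_{m-3}$ for $m\ge 1$, and let $B(n)$ be the number of distinct cubes occurring in the prefix $\mathbb{T}[1,n]$ of the Tribonacci sequence $\mathbb{T}$. For $m\le 6$, $B(t_m)=0$; for $m\ge 7$, $$B(t_m)=\frac{t_{m-5}+t_{m-6}-m+3}{2}.$$
   Context: The Tribonacci sequence $\mathbb{T}$ is the infinite word over $\{a,b,c\}$ that is the fixed point beginning with $a$ of the substitution $\sigma(a)=ab$, $\sigma(b)=ac$, $\sigma(c)=a$. Letters are indexed from $1$, and $\mathbb{T}[1,n]$ denotes the prefix of $\mathbb{T}$ of length $n$ (empty if $n=0$). The notation $u\prec v$ means that $u$ is a factor (contiguous subword) of $v$. The number of distinct cubes is $B(n)=\sharp\{\omega : \omega \text{ a nonempty finite word},\ \omega\omega\omega\prec\mathbb{T}[1,n]\}$. *)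

theory Defs
  imports Complex_Main "HOL-Library.Stream" "HOL-Library.Sublist"
begin

datatype letter = La | Lb | Lc

fun trib_subst :: "letter \<Rightarrow> letter list" where
  "trib_subst La = [La, Lb]"
| "trib_subst Lb = [La, Lc]"
| "trib_subst Lc = [La]"

definition trib_word :: "letter stream" where
  "trib_word = (THE w. shd w = La \<and> flat (smap trib_subst w) = w)"

text \<open>The paper indexes letters from 1, so its prefix \<open>T[1,n]\<close> is \<open>stake n trib_word\<close>.\<close>

definition num_cubes :: "nat \<Rightarrow> nat" where
  "num_cubes n = card {w. w \<noteq> [] \<and> sublist (w @ w @ w) (stake n trib_word)}"

text \<open>The index starts at \<open>-2\<close>; the value 0 below \<open>-2\<close> is a dummy.\<close>

function trib_num :: "int \<Rightarrow> nat" where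
  "trib_num m =
    (if m \<le> -2 then 0
     else if m \<le> 0 then 1
     else trib_num (m - 1) + trib_num (m - 2) + trib_num (m - 3))"
  by pat_completeness auto
termination by (relation "measure (\<lambda>m. nat (m + 2))") auto

declare trib_num.simps [simp del]


subsection \<open>Well-definedness of \<open>trib_word\<close> and \<open>num_cubes\<close>\<close>

lemma trib_subst_nonempty [simp]: "trib_subst x \<noteq> []"
  by (cases x) auto

definition subst_list :: "letter list \<Rightarrow> letter list" where
  "subst_list u = concat (map trib_subst u)"

lemma flat_subst_shift:
  "flat (smap trib_subst (u @- w)) = subst_list u @- flat (smap trib_subst w)"
  by (induction u) (auto simp: subst_list_def)

definition trib_iter :: "nat \<Rightarrow> letter list" where
  "trib_iter n = (subst_list ^^ n) [La]"

lemma trib_iter_Suc: "trib_iter (Suc n) = subst_list (trib_iter n)"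
  by (simp add: trib_iter_def)

lemma length_subst_list: "length u \<le> length (subst_list u)"
proof (induction u)
  case (Cons x u)
  then show ?case by (cases x) (auto simp: subst_list_def)
qed (simp add: subst_list_def)

lemma trib_iter_Cons: "\<exists>v. trib_iter n = La # v \<and> n \<le> length v"
proof (induction n)
  case 0
  show ?case by (simp add: trib_iter_def)
next
  case (Suc n)
  then obtain v where v: "trib_iter n = La # v" "n \<le> length v" by blast
  have "trib_iter (Suc n) = La # Lb # subst_list v"
    by (simp add: trib_iter_Suc v subst_list_def)
  with v(2) length_subst_list[of v] show ?case by auto
qed

lemma length_trib_iter: "n < length (trib_iter n)"
  using trib_iter_Cons[of n] by auto

lemma prefix_trib_iter_Suc: "prefix (trib_iter n) (trib_iter (Suc n))"
proof (induction n)
  case 0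
  show ?case by (simp add: trib_iter_def subst_list_def)
next
  case (Suc n)
  then obtain v where "trib_iter (Suc n) = trib_iter n @ v" by (auto simp: prefix_def)
  then have "trib_iter (Suc (Suc n)) = trib_iter (Suc n) @ subst_list v"
    by (metis trib_iter_Suc subst_list_def map_append concat_append)
  then show ?case by simp
qed

lemma prefix_trib_iter: "m \<le> n \<Longrightarrow> prefix (trib_iter m) (trib_iter n)"
  by (induction rule: dec_induct) (use prefix_trib_iter_Suc prefix_order.trans in blast)+

lemma stream_eqI_trib_iter:
  assumes "\<And>n. \<exists>v. w = trib_iter n @- v" "\<And>n. \<exists>v. w' = trib_iter n @- v"
  shows "w = w'"
proof -
  have "w !! i = w' !! i" for i
    using assms(1)[of i] assms(2)[of i] length_trib_iter[of i] by auto
  then show ?thesis using smap_alt[of "\<lambda>x. x" w w'] by (simp add: stream.map_ident)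
qed

lemma fixed_point_trib_iter:
  assumes "shd w = La" "flat (smap trib_subst w) = w"
  shows "\<exists>v. w = trib_iter n @- v"
proof (induction n)
  case 0
  have "w = trib_iter 0 @- stl w"
    using assms(1) stream.collapse[of w] by (simp add: trib_iter_def)
  then show ?case by blast
next
  case (Suc n)
  then obtain v where "w = trib_iter n @- v" by blast
  then have "w = trib_iter (Suc n) @- flat (smap trib_subst v)"
    using assms(2) flat_subst_shift[of "trib_iter n" v] by (simp add: trib_iter_Suc)
  then show ?case by blast
qed

lemma trib_word_ex1: "\<exists>!w. shd w = La \<and> flat (smap trib_subst w) = w"
proof
  define w where "w = smap (\<lambda>i. trib_iter i ! i) nats"
  have nth: "w !! i = trib_iter n ! i" if "i < length (trib_iter n)" for i n
  proof -
    have "trib_iter i ! i = trib_iter n ! i"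
    proof (cases "i \<le> n")
      case True
      then show ?thesis
        using prefix_trib_iter[of i n] length_trib_iter[of i] by (auto simp: prefix_def nth_append)
    next
      case False
      then show ?thesis
        using prefix_trib_iter[of n i] that by (auto simp: prefix_def nth_append)
    qed
    then show ?thesis by (simp add: w_def)
  qed
  have "stake (length (trib_iter n)) w = trib_iter n" for n
    by (rule nth_equalityI) (simp_all add: nth)
  then have split: "w = trib_iter n @- sdrop (length (trib_iter n)) w" for n
    by (metis stake_sdrop)
  have "\<exists>v. flat (smap trib_subst w) = trib_iter n @- v" for n
  proof -
    have "flat (smap trib_subst w) = trib_iter (Suc n) @-
        flat (smap trib_subst (sdrop (length (trib_iter n)) w))"
      using split[of n] flat_subst_shift by (metis trib_iter_Suc)
    moreover obtain u where "trib_iter (Suc n) = trib_iter n @ u"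
      using prefix_trib_iter_Suc[of n] by (auto simp: prefix_def)
    ultimately show ?thesis by auto
  qed
  then have "flat (smap trib_subst w) = w"
    by (rule stream_eqI_trib_iter) (use split in blast)
  moreover have "shd w = La"
    using nth[of 0 0] by (simp add: trib_iter_def)
  ultimately show "shd w = La \<and> flat (smap trib_subst w) = w" by blast
next
  fix w'
  assume w': "shd w' = La \<and> flat (smap trib_subst w') = w'"
  show "w' = smap (\<lambda>i. trib_iter i ! i) nats"
  proof -
    have "w' !! i = trib_iter i ! i" for i
      using fixed_point_trib_iter[of w' i] w' length_trib_iter[of i] by auto
    then show ?thesis
      using smap_alt[of "\<lambda>i. trib_iter i ! i" nats w'] by simp
  qed
qed

lemma trib_word_fixed_point:
  "shd trib_word = La" "flat (smap trib_subst trib_word) = trib_word"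
  using theI'[OF trib_word_ex1] unfolding trib_word_def by blast+

lemma finite_cubes: "finite {w. w \<noteq> [] \<and> sublist (w @ w @ w) (stake n trib_word)}"
proof (rule finite_subset)
  show "{w. w \<noteq> [] \<and> sublist (w @ w @ w) (stake n trib_word)} \<subseteq> set (sublists (stake n trib_word))"
    by (auto simp: sublist_def) (metis append.assoc)
qed simp

end

theory Submission
  imports Defs
begin

text \<open>
  Write \<open>\<sigma>\<close> for the substitution and \<open>T\<close> for its fixed point. A cube of period \<open>p\<close> at position
  \<open>s\<close> says that \<open>T\<close> read from \<open>s\<close> agrees with \<open>T\<close> read from \<open>s + p\<close> for \<open>2p\<close> letters, so the cubes
  are found by classifying all such agreements.

  Extend an agreement to the left until it is blocked, giving positions \<open>i < j\<close> that are preceded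
  by different letters or have \<open>i = 0\<close>. If \<open>T\<close> has the same letter at \<open>i\<close> and \<open>j\<close>, this letter is
  \<open>a\<close>, the mark of the beginning of a block \<open>\<sigma>(x)\<close>; hence \<open>i\<close> and \<open>j\<close> are images of earlier
  positions, and as the last letters of \<open>\<sigma>(a)\<close>, \<open>\<sigma>(b)\<close>, \<open>\<sigma>(c)\<close> are distinct, these are again
  blocked on the left. Descending, one reaches two positions \<open>i0 < j0\<close> with different letters and
  a number \<open>k\<close> of steps (\<open>left_maximal_origin\<close>). Going up again, the images under \<open>\<sigma>\<^sup>k\<close> of two
  streams with different first letters agree on exactly the word
  \<open>\<sigma>\<^bsup>k-1\<^esup>(a) \<dots> \<sigma>(a) a\<close> (\<open>mismatch_subst_stream_pow\<close>). So the agreement has length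
  \<open>S\<^sub>k = t\<^sub>0 + \<dots> + t\<^bsub>k-1\<^esub>\<close> and its period is the length of \<open>\<sigma>\<^sup>k(u)\<close>, where \<open>u\<close> is the factor of
  \<open>T\<close> between \<open>i0\<close> and \<open>j0\<close>. For a cube the period is at most half of \<open>S\<^sub>k\<close>, and this leaves
  only \<open>u = c\<close> (\<open>short_period_imp_Lc\<close>).

  Thus each pair of a level \<open>k\<close> and a letter \<open>c\<close> of \<open>T\<close> gives one run of period \<open>t\<^bsub>k-1\<^esub>\<close>, these
  runs contain all cubes, and the content of a run depends on \<open>k\<close> only. A run contains
  \<open>S\<^sub>k - 2 t\<^bsub>k-1\<^esub> + 1 = (t\<^bsub>k-2\<^esub> - t\<^bsub>k-4\<^esub> - 1) / 2\<close> cubes if \<open>k \<ge> 4\<close>, and none if \<open>k < 4\<close>.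
  They are pairwise distinct, because two equal ones would create a run of a smaller period that is
  longer than the classification permits (\<open>inj_on_cube_root\<close>). The first \<open>c\<close> of \<open>T\<close> is preceded by
  \<open>aba\<close>; this locates the first run of level \<open>k\<close>, whose cubes all end after \<open>t\<^bsub>k+2\<^esub>\<close> and not after
  \<open>t\<^bsub>k+3\<^esub>\<close>. The prefix of length \<open>t\<^sub>m\<close> therefore contains exactly the cubes of the levels
  \<open>4, \<dots>, m - 3\<close>, and the sum over these levels telescopes.
\<close>


section \<open>Iterating the substitution on lists and streams\<close>

definition subst_stream :: "letter stream \<Rightarrow> letter stream" where
  "subst_stream w = flat (smap trib_subst w)"

abbreviation subst_pow :: "nat \<Rightarrow> letter list \<Rightarrow> letter list" where
  "subst_pow k \<equiv> subst_list ^^ k"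

abbreviation subst_stream_pow :: "nat \<Rightarrow> letter stream \<Rightarrow> letter stream" where
  "subst_stream_pow k \<equiv> subst_stream ^^ k"

lemma stake_nth: "i < n \<Longrightarrow> stake n w ! i = w !! i"
  by (metis length_stake shift_snth_less stake_sdrop)

lemma subst_list_append: "subst_list (u @ v) = subst_list u @ subst_list v"
  by (simp add: subst_list_def)

lemma subst_pow_append: "subst_pow k (u @ v) = subst_pow k u @ subst_pow k v"
  by (induction k) (simp_all add: subst_list_append)

lemma subst_pow_Nil [simp]: "subst_pow k [] = []"
  by (induction k) (simp_all add: subst_list_def)

lemma subst_pow_Suc_single: "subst_pow (Suc k) [x] = subst_pow k (trib_subst x)"
  by (simp add: funpow_Suc_right subst_list_def del: funpow.simps)

lemma subst_stream_shift: "subst_stream (u @- w) = subst_list u @- subst_stream w"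
  by (simp only: subst_stream_def flat_subst_shift)

lemma subst_stream_Cons: "subst_stream (x ## w) = trib_subst x @- subst_stream w"
  using subst_stream_shift[of "[x]" w] by (simp add: subst_list_def)

lemma shd_subst_stream [simp]: "shd (subst_stream w) = La"
proof (cases w)
  case (SCons x z)
  then show ?thesis by (cases x) (simp_all add: subst_stream_Cons)
qed

lemma subst_stream_pow_shift:
  "subst_stream_pow k (u @- w) = subst_pow k u @- subst_stream_pow k w"
  by (induction k) (simp_all add: subst_stream_shift)

lemma subst_stream_pow_trib_word: "subst_stream_pow k trib_word = trib_word"
  by (induction k) (simp_all add: subst_stream_def trib_word_fixed_point)


section \<open>Images of positions\<close>

text \<open>The position in the fixed point at which the image under \<open>\<sigma>\<^sup>k\<close> of its letter number \<open>n\<close>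
  begins, counting from \<open>0\<close>.\<close>

definition pos :: "nat \<Rightarrow> nat \<Rightarrow> nat" where
  "pos k n = length (subst_pow k (stake n trib_word))"

lemma trib_word_decomp:
  "trib_word = subst_pow k (stake n trib_word) @- subst_stream_pow k (sdrop n trib_word)"
  by (metis stake_sdrop subst_stream_pow_shift subst_stream_pow_trib_word)

lemma sdrop_pos: "sdrop (pos k n) trib_word = subst_stream_pow k (sdrop n trib_word)"
proof -
  have "sdrop (pos k n) (subst_pow k (stake n trib_word) @- subst_stream_pow k (sdrop n trib_word))
      = subst_stream_pow k (sdrop n trib_word)"
    by (simp add: pos_def sdrop_shift)
  then show ?thesis using trib_word_decomp[of k n] by simp
qed

lemma stake_pos: "stake (pos k n) trib_word = subst_pow k (stake n trib_word)"
proof -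
  have "stake (pos k n) (subst_pow k (stake n trib_word) @- subst_stream_pow k (sdrop n trib_word))
      = subst_pow k (stake n trib_word)"
    by (simp add: pos_def stake_shift)
  then show ?thesis using trib_word_decomp[of k n] by simp
qed

lemma pos_add: "pos k (n + l) = pos k n + length (subst_pow k (stake l (sdrop n trib_word)))"
  by (simp add: pos_def subst_pow_append flip: stake_add)

lemma pos_0 [simp]: "pos k 0 = 0" "pos 0 n = n"
  by (simp_all add: pos_def)

lemma pos_Suc_iter: "pos (Suc k) n = pos 1 (pos k n)"
  by (simp add: pos_def stake_pos[unfolded pos_def])

lemma pos_mono: "m \<le> n \<Longrightarrow> pos k m \<le> pos k n"
  using pos_add[of k m "n - m"] by simp

lemma pos_1_Suc: "pos 1 (Suc n) = pos 1 n + length (trib_subst (trib_word !! n))"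
  using pos_add[of 1 n 1] by (simp add: subst_list_def)

lemma sdrop_pos_1:
  "sdrop (pos 1 n) trib_word = trib_subst (trib_word !! n) @- sdrop (pos 1 (Suc n)) trib_word"
proof -
  have "sdrop n trib_word = trib_word !! n ## sdrop (Suc n) trib_word"
    by (metis sdrop_simps stream.collapse)
  then show ?thesis
    using sdrop_pos[of 1 n] sdrop_pos[of 1 "Suc n"] by (simp add: subst_stream_Cons)
qed

lemma nth_pos_1:
  "l < length (trib_subst (trib_word !! n)) \<Longrightarrow>
   trib_word !! (pos 1 n + l) = trib_subst (trib_word !! n) ! l"
  using sdrop_snth[of "pos 1 n" trib_word l] sdrop_pos_1[of n] by simp

lemma pos_1_gt:
  assumes "0 < n"
  shows "n < pos 1 n"
proof -
  have "Suc n < pos 1 (Suc n)" for n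
  proof (induction n)
    case 0
    show ?case using trib_word_fixed_point(1) pos_1_Suc[of 0] by simp
  next
    case (Suc n)
    have "0 < length (trib_subst (trib_word !! Suc n))" by simp
    with Suc show ?case using pos_1_Suc[of "Suc n"] by linarith
  qed
  then show ?thesis using assms by (cases n) auto
qed

lemma nth_pos_1_eq_La: "trib_word !! pos 1 n = La"
  using nth_pos_1[of 0 n] by (cases "trib_word !! n") auto

text \<open>Every image of a letter is \<open>a\<close>, possibly followed by one letter other than \<open>a\<close>; so the
  letters \<open>a\<close> mark where the blocks begin, and the word can be desubstituted in only one way.\<close>

lemma block_boundary:
  "(\<exists>n'. n = pos 1 n') \<or> (0 < n \<and> trib_word !! n \<noteq> La \<and> (\<exists>n'. n - 1 = pos 1 n'))"
proof (induction n)
  case 0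
  show ?case by (intro disjI1 exI[of _ 0]) simp
next
  case (Suc n)
  have next_start: "Suc n = pos 1 (Suc n') \<or>
      trib_word !! Suc n \<noteq> La" if "n = pos 1 n'" for n'
    using that pos_1_Suc[of n'] nth_pos_1[of 1 n']
    by (cases "trib_word !! n'") auto
  have "Suc n = pos 1 (Suc n')" if "trib_word !! n \<noteq> La" "n - 1 = pos 1 n'" "0 < n" for n'
  proof -
    have n: "n = Suc (pos 1 n')" using that by simp
    then have "pos 1 (Suc n') \<noteq> n" using that(1) nth_pos_1_eq_La by metis
    then show ?thesis using n pos_1_Suc[of n'] by (cases "trib_word !! n'") auto
  qed
  then show ?case using Suc next_start by (metis diff_Suc_1 zero_less_Suc)
qed

lemma La_imp_pos: "trib_word !! n = La \<Longrightarrow> \<exists>n'. n = pos 1 n'"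
  using block_boundary[of n] by blast

lemma before_non_La: "trib_word !! n \<noteq> La \<Longrightarrow> 0 < n \<and> trib_word !! (n - 1) = La"
  using block_boundary[of n] nth_pos_1_eq_La by metis

lemma after_Lc:
  assumes "trib_word !! n = Lc"
  shows "trib_word !! Suc n = La"
  using before_non_La[of "Suc n"] assms by auto

text \<open>The images \<open>ab\<close>, \<open>ac\<close>, \<open>a\<close> have distinct last letters, so the letter just before a block
  beginning reveals the preceding letter of the desubstituted word.\<close>

lemma last_of_block:
  "trib_word !! (pos 1 (Suc n) - 1) = last (trib_subst (trib_word !! n))"
proof -
  have "0 < length (trib_subst (trib_word !! n))" by simp
  then show ?thesis
    using nth_pos_1[of "length (trib_subst (trib_word !! n)) - 1" n] pos_1_Suc[of n]
    by (simp add: last_conv_nth Suc_leI)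
qed


section \<open>Descending from a left-maximal pair of positions\<close>

text \<open>No agreement between the words read from \<open>i\<close> and from \<open>j\<close> can be extended to the left.\<close>

definition left_maximal :: "nat \<Rightarrow> nat \<Rightarrow> bool" where
  "left_maximal i j \<longleftrightarrow> i = 0 \<or> trib_word !! (i - 1) \<noteq> trib_word !! (j - 1)"

text \<open>A common letter other than \<open>a\<close> would be preceded by \<open>a\<close> at both positions, against
  left-maximality. So the common letter is \<open>a\<close>, and both positions begin a block.\<close>

lemma left_maximal_desubst:
  assumes "i < j" "left_maximal i j" "trib_word !! i = trib_word !! j"
  obtains i' j' where "i = pos 1 i'" "j = pos 1 j'" "i' < j'" "j' < j" "left_maximal i' j'"
proof -
  have "trib_word !! i = La"
    using assms before_non_La[of i] before_non_La[of j]
    by (cases "trib_word !! j = La") (auto simp: left_maximal_def)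
  then obtain i' j' where ij: "i = pos 1 i'" "j = pos 1 j'"
    using La_imp_pos assms(3) by metis
  have less: "i' < j'"
    using assms(1) pos_mono[of j' i' 1] unfolding ij by (meson leD leI)
  then have "j' < j" using pos_1_gt[of j'] ij by simp
  moreover have "left_maximal i' j'"
  proof (cases i')
    case (Suc m)
    obtain n where n: "j' = Suc n" using less by (cases j') auto
    have "pos 1 i' > 0" using pos_1_gt[of i'] Suc by simp
    then have "last (trib_subst (trib_word !! m)) \<noteq> last (trib_subst (trib_word !! n))"
      using assms(2) last_of_block[of m] last_of_block[of n]
      unfolding left_maximal_def ij Suc n by simp
    then show ?thesis by (auto simp: left_maximal_def Suc n)
  qed (simp add: left_maximal_def)
  ultimately show thesis using that ij less by blast
qed

lemma left_maximal_origin: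
  "i < j \<Longrightarrow> left_maximal i j \<Longrightarrow>
   \<exists>k i0 j0. i0 < j0 \<and> i = pos k i0 \<and> j = pos k j0 \<and> trib_word !! i0 \<noteq> trib_word !! j0"
proof (induction j arbitrary: i rule: less_induct)
  case (less j)
  show ?case
  proof (cases "trib_word !! i = trib_word !! j")
    case True
    then obtain i' j' where d: "i = pos 1 i'" "j = pos 1 j'" "i' < j'" "j' < j" "left_maximal i' j'"
      using left_maximal_desubst less.prems by blast
    then obtain k i0 j0 where "i0 < j0" "i' = pos k i0" "j' = pos k j0"
        "trib_word !! i0 \<noteq> trib_word !! j0"
      using less.IH by blast
    then show ?thesis using d pos_Suc_iter by metis
  next
    case False
    then show ?thesis using less.prems pos_0(2) by metis
  qed
qed


section \<open>The common prefix of images of distinct letters\<close>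

text \<open>If two streams begin with different letters, their images under \<open>\<sigma>\<close> share the letter \<open>a\<close> and
  then differ: the next letters are \<open>b\<close>, \<open>c\<close>, \<open>a\<close> according to the first letter \<open>a\<close>, \<open>b\<close>, \<open>c\<close>.
  Iterating this yields the following word as the longest common prefix after \<open>k\<close> steps, whichever
  two letters the streams begin with.\<close>

fun overlap :: "nat \<Rightarrow> letter list" where
  "overlap 0 = []"
| "overlap (Suc k) = subst_list (overlap k) @ [La]"

text \<open>Unfolding from the other end shows the word to be \<open>\<sigma>\<^bsup>k-1\<^esup>(a) \<dots> \<sigma>(a) a\<close>; this form gives its
  length.\<close>

lemma overlap_Suc: "overlap (Suc k) = subst_pow k [La] @ overlap k"
proof (induction k)
  case (Suc k)
  then show ?case by (metis append.assoc funpow.simps(2) o_apply overlap.simps(2) subst_list_append)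
qed (simp add: subst_list_def)

lemma mismatch_subst_stream:
  assumes "shd X \<noteq> shd Y"
  obtains X' Y' where "subst_stream X = La ## X'" "subst_stream Y = La ## Y'" "shd X' \<noteq> shd Y'"
proof -
  have *: "subst_stream X = La ## stl (subst_stream X)" for X
    using stream.collapse[of "subst_stream X"] by simp
  have second: "shd (stl (subst_stream X)) =
      (case shd X of La \<Rightarrow> Lb | Lb \<Rightarrow> Lc | Lc \<Rightarrow> La)" for X
    by (cases X; cases "shd X") (auto simp: subst_stream_Cons)
  show thesis
    by (rule that[OF * *]) (use assms in \<open>auto simp: second split: letter.splits\<close>)
qed

lemma mismatch_subst_stream_pow:
  assumes "shd X \<noteq> shd Y"
  shows "\<exists>X' Y'. subst_stream_pow k X = overlap k @- X' \<and>
    subst_stream_pow k Y = overlap k @- Y' \<and> shd X' \<noteq> shd Y'"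
proof (induction k)
  case (Suc k)
  then obtain X' Y' where "subst_stream_pow k X = overlap k @- X'"
      "subst_stream_pow k Y = overlap k @- Y'" "shd X' \<noteq> shd Y'" by blast
  moreover from mismatch_subst_stream[OF this(3)] obtain X2 Y2 where
    "subst_stream X' = La ## X2" "subst_stream Y' = La ## Y2" "shd X2 \<noteq> shd Y2" by blast
  ultimately show ?case by (auto simp: subst_stream_shift)
qed (use assms in simp)

lemma mismatch_pos:
  assumes "trib_word !! i \<noteq> trib_word !! j"
  shows "trib_word !! (pos k i + length (overlap k)) \<noteq> trib_word !! (pos k j + length (overlap k))"
proof -
  obtain X Y where "sdrop (pos k i) trib_word = overlap k @- X"
      "sdrop (pos k j) trib_word = overlap k @- Y" "shd X \<noteq> shd Y"
    using mismatch_subst_stream_pow[of "sdrop i trib_word" "sdrop j trib_word" k] assms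
    by (auto simp: sdrop_pos)
  then show ?thesis
    using sdrop_snth[of "pos k i" trib_word "length (overlap k)"]
      sdrop_snth[of "pos k j" trib_word "length (overlap k)"] by simp
qed


section \<open>Tribonacci lengths\<close>

lemma trib_num_rec: "1 \<le> m \<Longrightarrow> trib_num m = trib_num (m - 1) + trib_num (m - 2) + trib_num (m - 3)"
  by (subst trib_num.simps) simp

lemma trib_num_small:
  "m \<le> -2 \<Longrightarrow> trib_num m = 0" "trib_num (-1) = 1" "trib_num 0 = 1" "trib_num 1 = 2"
  "trib_num 2 = 4" "trib_num 3 = 7"
  by (simp_all add: trib_num.simps)

lemma trib_num_mono: "m \<le> n \<Longrightarrow> trib_num m \<le> trib_num n"
proof (induction n rule: int_ge_induct)
  case (step n)
  have "trib_num n \<le> trib_num (n + 1)"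
  proof (cases "0 \<le> n")
    case True
    then show ?thesis using trib_num_rec[of "n + 1"] by simp
  next
    case False
    then consider "n \<le> -2" | "n = -1" by linarith
    then show ?thesis by cases (simp_all add: trib_num_small)
  qed
  with step show ?case by simp
qed simp

lemma trib_num_le_double: "0 \<le> m \<Longrightarrow> trib_num m \<le> 2 * trib_num (m - 1)"
  using trib_num_rec[of m] trib_num_rec[of "m - 1"] trib_num_small
  by (cases "m = 0"; cases "m = 1") auto

lemma length_subst_pow_letter:
  "length (subst_pow k [La]) = trib_num (int k)"
  "length (subst_pow k [Lb]) = trib_num (int k - 1) + trib_num (int k - 2)"
  "length (subst_pow k [Lc]) = trib_num (int k - 1)"
proof (induction k)
  case (Suc k)
  have pair: "subst_pow k [x, y] = subst_pow k [x] @ subst_pow k [y]" for x y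
    using subst_pow_append[of k "[x]" "[y]"] by simp
  case 1
  show ?case using Suc trib_num_rec[of "int k + 1"]
    by (simp add: subst_pow_Suc_single pair add.commute del: funpow.simps)
  case 2
  show ?case using Suc
    by (simp add: subst_pow_Suc_single pair del: funpow.simps)
  case 3
  show ?case using Suc
    by (simp add: subst_pow_Suc_single pair del: funpow.simps)
qed (simp_all add: trib_num_small)

text \<open>Both sides satisfy the same recurrence: the coefficients \<open>1, 2, 1\<close> and the constant \<open>3\<close> come
  from solving for the partial sums \<open>t\<^sub>0 + \<dots> + t\<^bsub>k-1\<^esub>\<close> as a combination of three consecutive
  Tribonacci numbers and a constant.\<close>

lemma length_overlap:
  "2 * length (overlap k) + 3 = trib_num (int k) + 2 * trib_num (int k - 1) + trib_num (int k - 2)"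
proof (induction k)
  case (Suc k)
  have "length (overlap (Suc k)) = trib_num (int k) + length (overlap k)"
    by (simp only: overlap_Suc length_append length_subst_pow_letter)
  then show ?case using Suc trib_num_rec[of "int k + 1"] by (simp add: add.commute)
qed (simp add: trib_num_small)

lemma length_overlap_less: "length (overlap k) < 2 * trib_num (int k)"
  using length_overlap[of k] trib_num_mono[of "int k - 1" "int k"]
    trib_num_mono[of "int k - 2" "int k"] by simp

text \<open>In the limit the overlap has length \<open>1.19 t\<^sub>k\<close>, while \<open>a\<close>, \<open>b\<close>, \<open>c\<close> have images of lengths
  \<open>t\<^sub>k\<close>, \<open>0.84 t\<^sub>k\<close>, \<open>0.54 t\<^sub>k\<close>. So \<open>c\<close> fits twice, \<open>a\<close> and \<open>b\<close> do
  not, and a word of two or more letters does not either, its image having length at least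
  \<open>1.08 t\<^sub>k\<close>.\<close>

lemma short_period_imp_Lc:
  assumes "u \<noteq> []" "2 * length (subst_pow k u) \<le> length (overlap k)"
  shows "u = [Lc]"
proof -
  define t where "t j = trib_num (int k - j)" for j
  have dbl: "t 0 \<le> 2 * t 1" using trib_num_le_double[of "int k"] by (simp add: t_def)
  have mono: "t 2 \<le> t 1" "t 1 \<le> t 0" using trib_num_mono by (simp_all add: t_def)
  have S: "2 * length (overlap k) + 3 = t 0 + 2 * t 1 + t 2"
    using length_overlap[of k] by (simp add: t_def)
  have len: "length (subst_pow k [La]) = t 0" "length (subst_pow k [Lb]) = t 1 + t 2"
    "length (subst_pow k [Lc]) = t 1"
    by (simp_all add: t_def length_subst_pow_letter)
  have ge: "t 1 \<le> length (subst_pow k [x])" for x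
    using len mono by (cases x) auto
  obtain x v where u: "u = x # v" using assms(1) by (cases u) auto
  have split: "length (subst_pow k (x # v)) = length (subst_pow k [x]) + length (subst_pow k v)" for x v
    using subst_pow_append[of k "[x]" v] by simp
  have "v = []"
  proof (cases v)
    case (Cons y z)
    then have "2 * t 1 \<le> length (subst_pow k u)"
      using ge[of x] ge[of y] split[of x v] split[of y z] u by simp
    then show ?thesis using assms(2) S dbl mono by linarith
  qed
  moreover have "x = Lc"
    using assms(2) S dbl mono len u \<open>v = []\<close> by (cases x) auto
  ultimately show ?thesis using u by simp
qed

text \<open>The number of starting positions of cubes in a run of level \<open>k\<close>, in the form that telescopes.\<close>

lemma overlap_excess:
  assumes "4 \<le> k"
  shows "2 * trib_num (int k - 1) \<le> length (overlap k)"
    "2 * (length (overlap k) - 2 * trib_num (int k - 1) + 1) + trib_num (int k - 4) + 1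
      = trib_num (int k - 2)"
proof -
  define t where "t j = trib_num (int k - j)" for j
  have r: "t 0 = t 1 + t 2 + t 3" "t 1 = t 2 + t 3 + t 4"
    using trib_num_rec[of "int k"] trib_num_rec[of "int k - 1"] assms by (simp_all add: t_def)
  have S: "2 * length (overlap k) + 3 = t 0 + 2 * t 1 + t 2"
    using length_overlap[of k] by (simp add: t_def)
  have "t 4 + 3 \<le> t 2"
  proof (cases "k = 4")
    case True
    then show ?thesis by (simp add: t_def trib_num_small)
  next
    case False
    then have "t 2 = t 3 + t 4 + t 5" "2 \<le> t 3" "1 \<le> t 5"
      using trib_num_rec[of "int k - 2"] assms trib_num_mono[of 1 "int k - 3"]
        trib_num_mono[of 0 "int k - 5"] by (simp_all add: t_def trib_num_small)
    then show ?thesis by linarith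
  qed
  then have le: "2 * t 1 \<le> length (overlap k)" using r S by linarith
  then obtain c where "length (overlap k) = 2 * t 1 + c" by (auto simp: le_iff_add)
  then have "2 * (length (overlap k) - 2 * t 1 + 1) + t 4 + 1 = t 2"
    using r S by simp
  with le have "2 * t 1 \<le> length (overlap k)"
    "2 * (length (overlap k) - 2 * t 1 + 1) + t 4 + 1 = t 2" by blast+
  then show "2 * trib_num (int k - 1) \<le> length (overlap k)"
    "2 * (length (overlap k) - 2 * trib_num (int k - 1) + 1) + trib_num (int k - 4) + 1
      = trib_num (int k - 2)"
    by (simp_all add: t_def)
qed

lemma overlap_excess_imp_ge_4:
  assumes "2 * trib_num (int k - 1) \<le> length (overlap k)"
  shows "4 \<le> k"
proof (rule ccontr)
  assume "\<not> 4 \<le> k"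
  then consider "k = 0" | "k = 1" | "k = 2" | "k = 3" by linarith
  then show False
    using assms length_overlap[of k] by cases (simp_all add: trib_num_small)
qed


section \<open>Repetitions of exponent at least three\<close>

definition period_match :: "nat \<Rightarrow> nat \<Rightarrow> nat \<Rightarrow> bool" where
  "period_match s e N \<longleftrightarrow> (\<forall>x<N. trib_word !! (s + x) = trib_word !! (s + e + x))"

lemma period_matchD:
  assumes "period_match s e N" "s \<le> y" "y < s + N"
  shows "trib_word !! y = trib_word !! (y + e)"
proof -
  from assms(2) obtain x where "y = s + x" by (auto simp: le_iff_add)
  moreover have "trib_word !! (s + x) = trib_word !! (s + e + x)"
    using assms calculation by (simp add: period_match_def)
  moreover have "s + e + x = s + x + e" by simp
  ultimately show ?thesis by metis
qed

text \<open>The heart of the proof: an agreement at least twice as long as its period lies inside the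
  agreement that some letter \<open>c\<close> produces with its successor at some level \<open>k\<close>.\<close>

lemma period_match_classification:
  assumes "0 < e" "2 * e \<le> N" "period_match s e N"
  obtains k i where "trib_word !! i = Lc" "e = trib_num (int k - 1)"
    "pos k i \<le> s" "s + N \<le> pos k i + length (overlap k)"
proof -
  (* i is the left end of the agreement, extended as far as possible to the left. *)
  define P where "P i \<longleftrightarrow> i \<le> s \<and> (\<forall>y. i \<le> y \<and> y < s \<longrightarrow> trib_word !! y = trib_word !! (y + e))" for i
  define i where "i = (LEAST i. P i)"
  have "P s" unfolding P_def by auto
  then have "P i" unfolding i_def by (rule LeastI)
  have "left_maximal i (i + e)"
  proof (rule ccontr)
    assume "\<not> left_maximal i (i + e)"
    then have i: "0 < i" and eq: "trib_word !! (i - 1) = trib_word !! (i - 1 + e)"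
      by (auto simp: left_maximal_def)
    have "P (i - 1)"
      unfolding P_def
    proof (intro conjI allI impI)
      fix y assume "i - 1 \<le> y \<and> y < s"
      then show "trib_word !! y = trib_word !! (y + e)"
        using \<open>P i\<close> eq i by (cases "y = i - 1") (auto simp: P_def)
    qed (use \<open>P i\<close> in \<open>auto simp: P_def\<close>)
    then have "i \<le> i - 1" unfolding i_def by (rule Least_le)
    with i show False by simp
  qed
  then obtain k i0 j0 where o: "i0 < j0" "i = pos k i0" "i + e = pos k j0"
      "trib_word !! i0 \<noteq> trib_word !! j0"
    using left_maximal_origin[of i "i + e"] assms(1) by auto
  have agree: "trib_word !! y = trib_word !! (y + e)" if "i \<le> y" "y < s + N" for y
  proof (cases "y < s")
    case False
    with that show ?thesis by (intro period_matchD[OF assms(3)]) simp_all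
  qed (use that \<open>P i\<close> in \<open>unfold P_def, blast\<close>)
  have "trib_word !! (i + length (overlap k)) \<noteq> trib_word !! (i + length (overlap k) + e)"
    using mismatch_pos[OF o(4), of k] unfolding o(2,3)[symmetric] 
    by (simp only: add_ac not_False_eq_True)
  then have bound: "s + N \<le> i + length (overlap k)"
    using agree[of "i + length (overlap k)"] by (meson le_add1 not_le)
  (* The period is the length of the image of the factor u between the two original positions. *)
  define u where "u = stake (j0 - i0) (sdrop i0 trib_word)"
  have "e = length (subst_pow k u)"
    using pos_add[of k i0 "j0 - i0"] o by (simp add: u_def)
  moreover have "u = [Lc]"
  proof (rule short_period_imp_Lc)
    show "2 * length (subst_pow k u) \<le> length (overlap k)"
      using calculation bound assms(2) \<open>P i\<close> by (simp add: P_def)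
  qed (use o(1) in \<open>simp add: u_def\<close>)
  ultimately have "e = trib_num (int k - 1)" by (simp add: length_subst_pow_letter)
  moreover have "trib_word !! i0 = Lc"
    using \<open>u = [Lc]\<close> o(1) by (cases "j0 - i0") (auto simp: u_def)
  ultimately show thesis
    using that[of i0 k] bound \<open>P i\<close> o(2) by (simp add: P_def)
qed

text \<open>Since \<open>c\<close> is followed by a different letter, the images of the stream at \<open>c\<close> and of the
  stream after it both begin with the overlap. The second of them starts after \<open>\<sigma>\<^sup>k(c)\<close>, and so the
  run is fixed on all of \<open>\<sigma>\<^sup>k(c)\<close> followed by the overlap and has period \<open>t\<^bsub>k-1\<^esub>\<close> there.\<close>

lemma run_content:
  assumes "trib_word !! i = Lc"
  obtains X Y where "sdrop (pos k i) trib_word = overlap k @- X"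
    "sdrop (pos k i) trib_word = (subst_pow k [Lc] @ overlap k) @- Y"
proof -
  have eq: "sdrop i trib_word = [Lc] @- sdrop (Suc i) trib_word"
    using assms by (metis sdrop_simps shift.simps stream.collapse)
  obtain X Y where XY: "subst_stream_pow k (sdrop i trib_word) = overlap k @- X"
      "subst_stream_pow k (sdrop (Suc i) trib_word) = overlap k @- Y"
    using mismatch_subst_stream_pow[of "sdrop i trib_word" "sdrop (Suc i) trib_word" k]
      after_Lc[OF assms] assms by auto
  have "sdrop (pos k i) trib_word = subst_stream_pow k ([Lc] @- sdrop (Suc i) trib_word)"
    by (simp only: sdrop_pos eq)
  also have "\<dots> = (subst_pow k [Lc] @ overlap k) @- Y"
    by (simp only: subst_stream_pow_shift XY(2) shift_append)
  finally have "sdrop (pos k i) trib_word = (subst_pow k [Lc] @ overlap k) @- Y" .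
  moreover have "sdrop (pos k i) trib_word = overlap k @- X"
    by (simp only: sdrop_pos XY(1))
  ultimately show thesis using that by blast
qed

lemma run_period_match:
  assumes "trib_word !! i = Lc" "d + N \<le> length (overlap k)"
  shows "period_match (pos k i + d) (trib_num (int k - 1)) N"
  unfolding period_match_def
proof (intro allI impI)
  fix x assume x: "x < N"
  define p where "p = length (subst_pow k [Lc])"
  obtain X Y where run: "sdrop (pos k i) trib_word = overlap k @- X"
    "sdrop (pos k i) trib_word = (subst_pow k [Lc] @ overlap k) @- Y"
    by (rule run_content[OF assms(1)])
  have "trib_word !! (pos k i + (d + x)) = overlap k ! (d + x)"
    using x assms(2) sdrop_snth[of "pos k i" trib_word "d + x"] by (simp add: run(1))
  also have "\<dots> = trib_word !! (pos k i + (p + (d + x)))"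
    using x assms(2) sdrop_snth[of "pos k i" trib_word "p + (d + x)"]
    by (simp add: run(2) p_def nth_append)
  finally show "trib_word !! (pos k i + d + x) =
      trib_word !! (pos k i + d + trib_num (int k - 1) + x)"
    by (simp add: p_def length_subst_pow_letter add_ac)
qed


section \<open>Cubes as periodic agreements\<close>

lemma sublist_stake_iff:
  "sublist v (stake n w) \<longleftrightarrow> (\<exists>s. s + length v \<le> n \<and> v = stake (length v) (sdrop s w))"
proof
  assume "sublist v (stake n w)"
  then obtain x y where xy: "stake n w = x @ v @ y" by (auto simp: sublist_def)
  have "length (stake n w) = length (x @ v @ y)" by (simp only: xy)
  then have len: "n = length x + (length v + length y)" by simp
  have "stake n w = stake (length x) w @ stake (length v) (sdrop (length x) w)
      @ stake (length y) (sdrop (length x + length v) w)"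
    unfolding len by (simp flip: stake_add)
  with xy have "v = stake (length v) (sdrop (length x) w)" by simp
  moreover have "length x + length v \<le> n" using len by simp
  ultimately show "\<exists>s. s + length v \<le> n \<and> v = stake (length v) (sdrop s w)" by blast
next
  assume "\<exists>s. s + length v \<le> n \<and> v = stake (length v) (sdrop s w)"
  then obtain s where s: "s + length v \<le> n" "v = stake (length v) (sdrop s w)" by blast
  then have "n = s + (length v + (n - s - length v))" by simp
  then have "stake n w = stake s w @ stake (length v) (sdrop s w)
      @ stake (n - s - length v) (sdrop (s + length v) w)"
    by (metis stake_add sdrop_add)
  with s(2) show "sublist v (stake n w)" by (metis sublist_appendI)
qed

lemma stake_sdrop_eq_iff:
  "stake n (sdrop a w) = stake n (sdrop b w) \<longleftrightarrow> (\<forall>x<n. w !! (a + x) = w !! (b + x))"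
  by (simp add: list_eq_iff_nth_eq stake_nth sdrop_snth)

lemma cube_iff:
  "sublist (w @ w @ w) (stake n trib_word) \<longleftrightarrow>
   (\<exists>s. s + 3 * length w \<le> n \<and> w = stake (length w) (sdrop s trib_word) \<and>
        period_match s (length w) (2 * length w))"
proof -
  define p where "p = length w"
  have len: "length (w @ w @ w) = p + (p + p)" by (simp add: p_def)
  have "w @ w @ w = stake (p + (p + p)) (sdrop s trib_word) \<longleftrightarrow>
      w = stake p (sdrop s trib_word) \<and> period_match s p (2 * p)" for s
  proof -
    have "w @ w @ w = stake (p + (p + p)) (sdrop s trib_word) \<longleftrightarrow>
      w = stake p (sdrop s trib_word) \<and> w @ w = stake (p + p) (sdrop (s + p) trib_word)"
      by (subst stake_add[symmetric]) (simp add: p_def)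
    also have "\<dots> \<longleftrightarrow> w = stake p (sdrop s trib_word) \<and>
        stake (p + p) (sdrop s trib_word) = stake (p + p) (sdrop (s + p) trib_word)"
    proof (intro conj_cong refl)
      assume w: "w = stake p (sdrop s trib_word)"
      have "w @ w = stake (p + p) (sdrop (s + p) trib_word) \<longleftrightarrow>
        w = stake p (sdrop (s + p) trib_word) \<and> w = stake p (sdrop (s + p + p) trib_word)"
        by (subst stake_add[symmetric]) (simp add: p_def)
      moreover have "stake (p + p) (sdrop s trib_word) = w @ stake p (sdrop (s + p) trib_word)"
        by (subst stake_add[symmetric]) (simp flip: w)
      moreover have "stake (p + p) (sdrop (s + p) trib_word) =
          stake p (sdrop (s + p) trib_word) @ stake p (sdrop (s + p + p) trib_word)"
        by (subst stake_add[symmetric]) simp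
      ultimately show "w @ w = stake (p + p) (sdrop (s + p) trib_word) \<longleftrightarrow>
        stake (p + p) (sdrop s trib_word) = stake (p + p) (sdrop (s + p) trib_word)"
        by (auto simp: p_def)
    qed
    finally show ?thesis
      by (simp add: stake_sdrop_eq_iff period_match_def mult_2)
  qed
  then show ?thesis
    unfolding sublist_stake_iff len by (simp add: p_def numeral_3_eq_3)
qed


section \<open>The cubes of a run\<close>

text \<open>The factor of length one period that starts \<open>d\<close> letters after the beginning of any run of
  level \<open>k\<close>; it is the root of a cube as long as two more periods fit into the overlap.\<close>

definition cube_root :: "nat \<Rightarrow> nat \<Rightarrow> letter list" where
  "cube_root k d = take (trib_num (int k - 1)) (drop d (subst_pow k [Lc] @ overlap k))"

lemma cube_root_in_run:
  assumes "trib_word !! i = Lc" "d \<le> length (overlap k)"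
  shows "stake (trib_num (int k - 1)) (sdrop (pos k i + d) trib_word) = cube_root k d"
proof -
  let ?U = "subst_pow k [Lc] @ overlap k"
  obtain Y where Y: "sdrop (pos k i) trib_word = ?U @- Y"
    by (rule run_content[OF assms(1)])
  have len: "length ?U = trib_num (int k - 1) + length (overlap k)"
    by (simp add: length_subst_pow_letter)
  have "sdrop (pos k i + d) trib_word = sdrop d (?U @- Y)"
    by (simp only: Y flip: sdrop_add)
  also have "\<dots> = drop d ?U @- Y"
    using assms(2) len unfolding sdrop_shift by simp
  also have "stake (trib_num (int k - 1)) (drop d ?U @- Y) = take (trib_num (int k - 1)) (drop d ?U)"
    using assms(2) len unfolding stake_shift length_drop by simp
  finally show ?thesis by (simp add: cube_root_def)
qed

lemma length_cube_root:
  "d \<le> length (overlap k) \<Longrightarrow> length (cube_root k d) = trib_num (int k - 1)"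
  by (simp add: cube_root_def length_subst_pow_letter)

lemma trib_word_start: "stake 4 trib_word = [La, Lb, La, Lc]"
proof -
  obtain v where "trib_word = trib_iter 2 @- v"
    using fixed_point_trib_iter[OF trib_word_fixed_point] by blast
  moreover have "trib_iter 2 = [La, Lb, La, Lc]"
    by (simp add: trib_iter_def subst_list_def numeral_2_eq_2)
  moreover have "stake 4 ([La, Lb, La, Lc] @- v) = [La, Lb, La, Lc]"
    by (simp add: numeral_eq_Suc)
  ultimately show ?thesis by simp
qed

lemma nth_trib_word_start: "i < 4 \<Longrightarrow> trib_word !! i = [La, Lb, La, Lc] ! i"
  using stake_nth[of i 4 trib_word] trib_word_start by simp

lemma trib_word_3: "trib_word !! 3 = Lc"
  using nth_trib_word_start[of 3] by simp

lemma Lc_ge_3: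
  assumes "trib_word !! i = Lc"
  shows "3 \<le> i"
proof (rule ccontr)
  assume "\<not> 3 \<le> i"
  then have "i = 0 \<or> i = 1 \<or> i = 2" by linarith
  then show False using nth_trib_word_start[of i] assms by auto
qed

lemma pos_3: "pos k 3 = 2 * trib_num (int k) + trib_num (int k - 1) + trib_num (int k - 2)"
proof -
  have "stake 3 trib_word = take 3 (stake 4 trib_word)" by (simp add: take_stake)
  then have "stake 3 trib_word = [La] @ [Lb] @ [La]" by (simp add: trib_word_start)
  then show ?thesis
    by (simp only: pos_def subst_pow_append length_append length_subst_pow_letter)
qed

text \<open>If two roots at distance \<open>e\<close> in one run were equal, then \<open>e\<close> would be a period of the run near
  them, with an agreement of length \<open>2p\<close>, where \<open>p = t\<^bsub>k-1\<^esub>\<close> is the period of the run. As \<open>e < p\<close>,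
  this agreement belongs to a level \<open>k' < k\<close>, whose overlap is shorter than
  \<open>2 t\<^bsub>k'\<^esub> \<le> 2p\<close>.\<close>

lemma inj_on_cube_root:
  "inj_on (cube_root k) {d. d + 2 * trib_num (int k - 1) \<le> length (overlap k)}"
proof -
  define p where "p = trib_num (int k - 1)"
  have collision: False if "d1 < d2" "d2 + 2 * p \<le> length (overlap k)" "cube_root k d1 = cube_root k d2" for d1 d2
  proof -
    define e where "e = d2 - d1"
    define s where "s = pos k 3 + d1"
    have "stake p (sdrop (pos k 3 + d1) trib_word) = stake p (sdrop (pos k 3 + d2) trib_word)"
      using that cube_root_in_run[OF trib_word_3] by (simp add: p_def)
    moreover have "pos k 3 + d2 = s + e" using that by (simp add: s_def e_def)
    ultimately have match1: "trib_word !! (s + x) = trib_word !! (s + e + x)" if "x < p" for x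
      using that unfolding stake_sdrop_eq_iff s_def by metis
    have per: "period_match (pos k 3 + d) p p" if "d + p \<le> length (overlap k)" for d
      using run_period_match[OF trib_word_3 that] by (simp add: p_def)
    have "period_match s e (2 * p)"
      unfolding period_match_def
    proof (intro allI impI)
      fix x assume "x < 2 * p"
      show "trib_word !! (s + x) = trib_word !! (s + e + x)"
      proof (cases "x < p")
        (* In the second period, shift both positions back by p. *)
        case False
        then obtain y where y: "x = p + y" "y < p" using \<open>x < 2 * p\<close> le_Suc_ex[of p x] by auto
        have "trib_word !! (s + y) = trib_word !! (s + y + p)"
          by (rule period_matchD[OF per[of d1]]) (use that y in \<open>simp_all add: s_def\<close>)
        moreover have "trib_word !! (s + e + y) = trib_word !! (s + e + y + p)"
          by (rule period_matchD[OF per[of d2]]) (use that y in \<open>simp_all add: s_def e_def\<close>)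
        moreover have "s + x = s + y + p" "s + e + x = s + e + y + p" using y by simp_all
        ultimately show ?thesis using match1[OF y(2)] by metis
      qed (rule match1)
    qed
    moreover have "0 < e" using that by (simp add: e_def)
    moreover have "e < p"
      using that length_overlap[of k] trib_num_le_double[of "int k"]
        trib_num_mono[of "int k - 2" "int k - 1"] by (simp add: e_def p_def)
    moreover from this have "2 * e \<le> 2 * p" by simp
    ultimately obtain k' i where k': "e = trib_num (int k' - 1)" "pos k' i \<le> s"
        "s + 2 * p \<le> pos k' i + length (overlap k')"
      using period_match_classification[of e "2 * p" s] by blast
    have "k' < k"
      using \<open>e < p\<close> trib_num_mono[of "int k - 1" "int k' - 1"] k'(1)
      unfolding p_def by (meson diff_right_mono leD leI of_nat_mono)
    then have "trib_num (int k') \<le> p" by (simp add: p_def trib_num_mono)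
    then show False using k' length_overlap_less[of k'] by linarith
  qed
  show ?thesis
  proof (rule inj_onI, unfold mem_Collect_eq)
    fix d1 d2
    assume "d1 + 2 * trib_num (int k - 1) \<le> length (overlap k)"
      "d2 + 2 * trib_num (int k - 1) \<le> length (overlap k)" "cube_root k d1 = cube_root k d2"
    then show "d1 = d2"
      using collision[of d1 d2] collision[of d2 d1] unfolding p_def
      by (cases d1 d2 rule: linorder_cases) simp_all
  qed
qed


section \<open>Counting the cubes in a prefix\<close>

text \<open>The first run of level \<open>k\<close> starts at \<open>pos k 3 = 2 t\<^sub>k + t\<^bsub>k-1\<^esub> + t\<^bsub>k-2\<^esub>\<close>. Its first cube ends
  \<open>3 t\<^bsub>k-1\<^esub>\<close> letters later, after \<open>t\<^bsub>k+2\<^esub> = 2 t\<^sub>k + 2 t\<^bsub>k-1\<^esub> + t\<^bsub>k-2\<^esub>\<close>; its last cube ends with the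
  run, which has fewer than \<open>t\<^bsub>k-1\<^esub> + 2 t\<^sub>k\<close> letters and so ends before
  \<open>t\<^bsub>k+3\<^esub> = 4 t\<^sub>k + 3 t\<^bsub>k-1\<^esub> + 2 t\<^bsub>k-2\<^esub>\<close>.\<close>

lemma cubes_of_trib_prefix:
  "{w. w \<noteq> [] \<and> sublist (w @ w @ w) (stake (trib_num m) trib_word)} =
   (\<Union>k\<in>{4..nat (m - 3)}. cube_root k ` {d. d + 2 * trib_num (int k - 1) \<le> length (overlap k)})"
  (is "?L = ?R")
proof (intro equalityI subsetI)
  fix w assume "w \<in> ?L"
  then obtain s where s: "s + 3 * length w \<le> trib_num m" "w = stake (length w) (sdrop s trib_word)"
      "period_match s (length w) (2 * length w)" and "w \<noteq> []"
    unfolding cube_iff by blast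
  have "0 < length w" using \<open>w \<noteq> []\<close> by simp
  then obtain k i where ki: "trib_word !! i = Lc" "length w = trib_num (int k - 1)"
    "pos k i \<le> s" "s + 2 * length w \<le> pos k i + length (overlap k)"
    using period_match_classification[of "length w" "2 * length w" s] s(3) by blast
  define d where "d = s - pos k i"
  have d: "s = pos k i + d" "d + 2 * trib_num (int k - 1) \<le> length (overlap k)"
    using ki by (simp_all add: d_def)
  then have "4 \<le> k" using overlap_excess_imp_ge_4 by simp
  have "w = cube_root k d"
    using cube_root_in_run[OF ki(1), of d k] d s(2) unfolding ki(2) by simp
  moreover have "int k + 2 < m"
  proof (rule ccontr)
    assume "\<not> int k + 2 < m"
    then have "trib_num m \<le> trib_num (int k + 2)" by (simp add: trib_num_mono)
    moreover have "trib_num (int k + 2) = 2 * trib_num (int k) + 2 * trib_num (int k - 1) + trib_num (int k - 2)"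
      using trib_num_rec[of "int k + 2"] trib_num_rec[of "int k + 1"] by (simp add: add.commute)
    moreover have "pos k 3 \<le> pos k i" using pos_mono Lc_ge_3 ki(1) by blast
    ultimately show False using s(1) ki \<open>0 < length w\<close> pos_3[of k] by linarith
  qed
  ultimately show "w \<in> ?R" using \<open>4 \<le> k\<close> d(2) by force
next
  fix w assume "w \<in> ?R"
  then obtain k d where k: "4 \<le> k" "k \<le> nat (m - 3)" and w: "w = cube_root k d"
    and d: "d + 2 * trib_num (int k - 1) \<le> length (overlap k)" by auto
  have len: "length w = trib_num (int k - 1)" using w d by (simp add: length_cube_root)
  have "1 \<le> trib_num (int k - 1)"
    using trib_num_mono[of 0 "int k - 1"] k by (simp add: trib_num_small)
  then have "w \<noteq> []" using len by auto
  have "trib_num (int k + 3) \<le> trib_num m" using k by (intro trib_num_mono) simp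
  moreover have "trib_num (int k + 3) = trib_num (int k + 2) + trib_num (int k + 1) + trib_num (int k)"
    "trib_num (int k + 2) = trib_num (int k + 1) + trib_num (int k) + trib_num (int k - 1)"
    "trib_num (int k + 1) = trib_num (int k) + trib_num (int k - 1) + trib_num (int k - 2)"
    using trib_num_rec[of "int k + 3"] trib_num_rec[of "int k + 2"] trib_num_rec[of "int k + 1"]
    by (simp_all add: add.commute)
  ultimately have "pos k 3 + d + 3 * length w \<le> trib_num m"
    using d len pos_3[of k] length_overlap_less[of k] by linarith
  moreover have "w = stake (length w) (sdrop (pos k 3 + d) trib_word)"
    using cube_root_in_run[OF trib_word_3, of d k] d len w by simp
  moreover have "period_match (pos k 3 + d) (length w) (2 * length w)"
    using run_period_match[OF trib_word_3] d len by simp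
  ultimately show "w \<in> ?L" using \<open>w \<noteq> []\<close> cube_iff by blast
qed

text \<open>Cubes of different levels have different periods, so the levels can be counted separately.\<close>

lemma num_cubes_eq_sum:
  "num_cubes (trib_num m) =
   (\<Sum>k\<in>{4..nat (m - 3)}. length (overlap k) - 2 * trib_num (int k - 1) + 1)"
proof -
  let ?D = "\<lambda>k. {d. d + 2 * trib_num (int k - 1) \<le> length (overlap k)}"
  have D: "?D k = {..length (overlap k) - 2 * trib_num (int k - 1)}" if "4 \<le> k" for k
    using overlap_excess(1)[OF that] by auto
  have disjoint: "cube_root k ` ?D k \<inter> cube_root k' ` ?D k' = {}"
    if "4 \<le> k" "4 \<le> k'" "k \<noteq> k'" for k k'
  proof (rule ccontr)
    assume meet: "\<not> ?thesis"
    have strict: "trib_num (int a - 1) < trib_num (int b - 1)" if "a < b" "4 \<le> a" for a b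
    proof -
      have "trib_num (int a) \<le> trib_num (int b - 1)" using that by (simp add: trib_num_mono)
      moreover have "0 < trib_num (int a - 2)"
        using trib_num_mono[of 0 "int a - 2"] that by (simp add: trib_num_small)
      ultimately show ?thesis using trib_num_rec[of "int a"] that by simp
    qed
    from meet obtain d d' where "d \<le> length (overlap k)" "d' \<le> length (overlap k')"
      "cube_root k d = cube_root k' d'" by fastforce
    then have "trib_num (int k - 1) = trib_num (int k' - 1)" by (metis length_cube_root)
    then show False using strict[of k k'] strict[of k' k] that by linarith
  qed
  have "num_cubes (trib_num m) = (\<Sum>k\<in>{4..nat (m - 3)}. card (cube_root k ` ?D k))"
    unfolding num_cubes_def cubes_of_trib_prefix
    by (intro card_UN_disjoint ballI impI disjoint) (simp_all add: D)
  also have "\<dots> = (\<Sum>k\<in>{4..nat (m - 3)}. length (overlap k) - 2 * trib_num (int k - 1) + 1)"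
    by (intro sum.cong refl, subst card_image[OF inj_on_cube_root]) (simp add: D)
  finally show ?thesis .
qed

text \<open>The terms \<open>t\<^bsub>k-2\<^esub> - t\<^bsub>k-4\<^esub> - 1\<close> telescope. The index \<open>n\<close> is \<open>m - 7\<close> for the prefix of length
  \<open>t\<^sub>m\<close>, so that \<open>n + 4\<close> is the last level.\<close>

lemma twice_sum_excess:
  "2 * (\<Sum>k\<in>{4..n + 4}. length (overlap k) - 2 * trib_num (int k - 1) + 1) + n + 4
    = trib_num (int n + 2) + trib_num (int n + 1)"
proof (induction n)
  case 0
  show ?case using overlap_excess(2)[of 4] by (simp add: trib_num_small)
next
  case (Suc n)
  define f where "f k = length (overlap k) - 2 * trib_num (int k - 1) + 1" for k
  have "2 * f (n + 5) + trib_num (int n + 1) + 1 = trib_num (int n + 3)"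
    using overlap_excess(2)[of "n + 5"] by (simp add: f_def add.commute)
  moreover have sum: "(\<Sum>k\<in>{4..Suc n + 4}. f k) = (\<Sum>k\<in>{4..n + 4}. f k) + f (n + 5)"
    by (simp add: eval_nat_numeral)
  moreover have idx: "int (Suc n) + 2 = int n + 3" "int (Suc n) + 1 = int n + 2" by simp_all
  moreover have "2 * (x + y) + Suc n + 4 = b + c"
    if "2 * y + a + 1 = b" "2 * x + n + 4 = c + a" for a b c x y :: nat
    using that by simp
  ultimately show ?case using Suc unfolding f_def[symmetric] sum idx by blast
qed

theorem theorem5p2:
  fixes m :: int
  assumes "-2 \<le> m"
  shows "(m \<le> 6 \<longrightarrow> num_cubes (trib_num m) = 0) \<and>
         (7 \<le> m \<longrightarrow> real (num_cubes (trib_num m)) =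
           (real (trib_num (m - 5)) + real (trib_num (m - 6)) - real_of_int m + 3) / 2)"
proof (intro conjI impI)
  assume "m \<le> 6"
  then show "num_cubes (trib_num m) = 0" by (simp add: num_cubes_eq_sum)
next
  assume "7 \<le> m"
  define n where "n = nat (m - 7)"
  have m: "m = int n + 7" using \<open>7 \<le> m\<close> by (simp add: n_def)
  have "nat (m - 3) = n + 4" by (simp add: m)
  moreover have "m - 5 = int n + 2" "m - 6 = int n + 1" using m by simp_all
  ultimately have "2 * num_cubes (trib_num m) + n + 4 = trib_num (m - 5) + trib_num (m - 6)"
    using twice_sum_excess[of n] by (simp only: num_cubes_eq_sum)
  then have "real (2 * num_cubes (trib_num m) + n + 4) = real (trib_num (m - 5) + trib_num (m - 6))"
    by (simp only:)
  then show "real (num_cubes (trib_num m)) =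
      (real (trib_num (m - 5)) + real (trib_num (m - 6)) - real_of_int m + 3) / 2"
    by (simp add: m)
qed

end
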